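(* Let $n \ge m \ge 1$ be integers. Let $\Delta_{m,n}$ be the $m\times n$ chessboard complex and $I_{\Delta_{m,n}}$ its Stanley--Reisner ideal. Then \[ \mathrm{v}(I_{\Delta_{m,n}})= \begin{cases} m-1, & \text{if } m=n,\\ m, & \text{if } n>m. \end{cases} \]
   Context: Let $\mathbb{K}$ be a field and $S=\mathbb{K}[x_{i,j}\mid 1\le i\le m,\ 1\le j\le n]$ the standard graded polynomial ring, $S_d$ its degree $d$ component. The variable $x_{i,j}$ is identified with the square in row $i$ and column $j$ of an $m\times n$ chessboard. Chessboard complex: $\Delta_{m,n}$ is the simplicial complex on the vertex set $V=\{x_{i,j}\mid 1\le i\le m,\ 1\le j\le n\}$ whose faces are the subsets of $V$ with no two squares in the same row or the same column. Stanley--Reisner ideal: for $F\subseteq V$ put $\mathbf{x}_F=\prod_{x\in F}x$. Then $I_{\Delta_{m,n}}=(\mathbf{x}_F\mid F\subseteq V,\ F\notin\Delta_{m,n})\subseteq S$. $\mathrm{v}$-number: for a graded ideal $I\subseteq S$, let $\operatorname{Ass}(I)$ be the set of associated primes of $I$ (i.e. of $S/I$). For $\mathfrak{p}\in\operatorname{Ass}(I)$ let $\mathrm{v}_{\mathfrak{p}}(I)=\min\{d\ge 0\mid \text{there exists } f\in S_d \text{ with } (I:f)=\mathfrak{p}\}$, and let $\mathrm{v}(I)=\min\{\mathrm{v}_{\mathfrak{p}}(I)\mid \mathfrak{p}\in\operatorname{Ass}(I)\}$. *)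

theory Defs
  imports
    "HOL-Algebra.QuotRing"
    "HOL-Library.Poly_Mapping"
    "HOL-Library.Extended_Nat"
begin

text \<open>
  A monomial is a finitely supported exponent vector \<open>'v \<Rightarrow>\<^sub>0 nat\<close>, and a polynomial is a finitely
  supported function from monomials to coefficients; with the convolution product of
  \<^theory>\<open>HOL-Library.Poly_Mapping\<close>, the type below is the polynomial ring with one variable
  for each element of \<open>'v\<close>.
\<close>

type_synonym ('v, 'k) mpoly = "('v \<Rightarrow>\<^sub>0 nat) \<Rightarrow>\<^sub>0 'k"

definition var :: "'v \<Rightarrow> ('v, 'k::field) mpoly" where
  "var v = Poly_Mapping.single (Poly_Mapping.single v 1) 1"

text \<open>The polynomial ring in the variables from \<open>V\<close> only.\<close>

definition poly_ring :: "'v set \<Rightarrow> ('v, 'k::field) mpoly ring" where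
  "poly_ring V =
    \<lparr>carrier = {f. \<forall>t \<in> Poly_Mapping.keys f. Poly_Mapping.keys t \<subseteq> V},
     mult = (*), one = 1, zero = 0, add = (+)\<rparr>"

definition mon_deg :: "('v \<Rightarrow>\<^sub>0 nat) \<Rightarrow> nat" where
  "mon_deg t = (\<Sum>v \<in> Poly_Mapping.keys t. Poly_Mapping.lookup t v)"

definition homogeneous_part :: "'v set \<Rightarrow> nat \<Rightarrow> ('v, 'k::field) mpoly set" where
  "homogeneous_part V d =
    {f \<in> carrier (poly_ring V). \<forall>t \<in> Poly_Mapping.keys f. mon_deg t = d}"

definition colon :: "('a, 'b) ring_scheme \<Rightarrow> 'a set \<Rightarrow> 'a \<Rightarrow> 'a set" where
  "colon R I f = {g \<in> carrier R. g \<otimes>\<^bsub>R\<^esub> f \<in> I}"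

text \<open>The prime ideals of \<open>R\<close> that are the annihilator of some element of \<open>R / I\<close>.\<close>

definition Ass :: "('a, 'b) ring_scheme \<Rightarrow> 'a set \<Rightarrow> 'a set set" where
  "Ass R I = {P. primeideal P R \<and>
     (\<exists>x \<in> carrier (R Quot I).
        P = {r \<in> carrier R. (I +>\<^bsub>R\<^esub> r) \<otimes>\<^bsub>R Quot I\<^esub> x = \<zero>\<^bsub>R Quot I\<^esub>})}"

text \<open>
  The minima are infima in \<^typ>\<open>enat\<close>: on a nonempty set the infimum is attained, and on the
  empty set it is \<open>\<infinity>\<close>. Hence a finite value can never come from an empty minimum.
\<close>

definition v_number_at :: "'v set \<Rightarrow> ('v, 'k::field) mpoly set \<Rightarrow> ('v, 'k) mpoly set \<Rightarrow> enat" where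
  "v_number_at V I P = Inf {enat d | d. \<exists>f \<in> homogeneous_part V d. colon (poly_ring V) I f = P}"

definition v_number :: "'v set \<Rightarrow> ('v, 'k::field) mpoly set \<Rightarrow> enat" where
  "v_number V I = Inf {v_number_at V I P | P. P \<in> Ass (poly_ring V) I}"

definition stanley_reisner_ideal :: "'v set \<Rightarrow> 'v set set \<Rightarrow> ('v, 'k::field) mpoly set" where
  "stanley_reisner_ideal V \<Delta> =
    Idl\<^bsub>poly_ring V\<^esub> {\<Prod>v\<in>F. var v | F. F \<subseteq> V \<and> F \<notin> \<Delta>}"

text \<open>The square in row \<open>i\<close> and column \<open>j\<close> is the pair \<open>(i, j)\<close>.\<close>

definition board :: "nat \<Rightarrow> nat \<Rightarrow> (nat \<times> nat) set" where
  "board m n = {1..m} \<times> {1..n}"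

definition chessboard_complex :: "nat \<Rightarrow> nat \<Rightarrow> (nat \<times> nat) set set" where
  "chessboard_complex m n =
    {F. F \<subseteq> board m n \<and>
        (\<forall>a\<in>F. \<forall>b\<in>F. a \<noteq> b \<longrightarrow> fst a \<noteq> fst b \<and> snd a \<noteq> snd b)}"

lemma cring_poly_ring: "cring (poly_ring V :: ('v, 'k::field) mpoly ring)"
proof (rule cringI)
  show "abelian_group (poly_ring V :: ('v, 'k) mpoly ring)"
  proof (rule abelian_groupI)
    fix f g :: "('v, 'k) mpoly"
    assume "f \<in> carrier (poly_ring V)" "g \<in> carrier (poly_ring V)"
    then show "f \<oplus>\<^bsub>poly_ring V\<^esub> g \<in> carrier (poly_ring V)"
      using keys_add[of f g] by (auto simp: poly_ring_def)
  next
    fix f :: "('v, 'k) mpoly"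
    assume "f \<in> carrier (poly_ring V)"
    then show "\<exists>g\<in>carrier (poly_ring V). g \<oplus>\<^bsub>poly_ring V\<^esub> f = \<zero>\<^bsub>poly_ring V\<^esub>"
      by (intro bexI[of _ "- f"]) (auto simp: poly_ring_def in_keys_iff)
  qed (auto simp: poly_ring_def algebra_simps)
  show "Group.comm_monoid (poly_ring V :: ('v, 'k) mpoly ring)"
  proof (rule Group.comm_monoidI)
    fix f g :: "('v, 'k) mpoly"
    assume fg: "f \<in> carrier (poly_ring V)" "g \<in> carrier (poly_ring V)"
    have "Poly_Mapping.keys t \<subseteq> V" if "t \<in> Poly_Mapping.keys (f * g)" for t
    proof -
      obtain a b where "t = a + b" "a \<in> Poly_Mapping.keys f" "b \<in> Poly_Mapping.keys g"
        using \<open>t \<in> _\<close> keys_mult[of f g] by auto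
      then show ?thesis
        using fg keys_add[of a b] by (fastforce simp: poly_ring_def)
    qed
    then show "f \<otimes>\<^bsub>poly_ring V\<^esub> g \<in> carrier (poly_ring V)"
      by (simp add: poly_ring_def)
  qed (auto simp: poly_ring_def algebra_simps)
qed (auto simp: poly_ring_def algebra_simps)

end

theory Submission
  imports Defs "HOL-Library.Product_Lexorder"
begin

text \<open>
  The two cases of the value are both \<open>min m (n - 1)\<close>, and this number has a direct meaning: it is
  the least size of a rook placement that lies in only one maximal rook placement. If \<open>m < n\<close>, a
  placement with a free row has a choice of columns for it, so all \<open>m\<close> rows must be filled; if
  \<open>m = n\<close>, the last rook is forced once \<open>m - 1\<close> rooks are placed.

  The link to algebra is that the Stanley-Reisner ideal \<open>I\<close> of a complex \<open>\<Delta>\<close> consists of the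
  polynomials all of whose monomials have a support outside \<open>\<Delta>\<close>
  (\<open>stanley_reisner_ideal_eq_nonface_span\<close>), so that membership is decided monomial by monomial.

  \<^item> Upper bound (\<open>v_number_le\<close>): if the faces compatible with a face \<open>A\<close> are exactly the subsets of
    one set \<open>D\<close>, then multiplying by \<open>\<Prod>v\<in>A. var v\<close> moves a monomial into \<open>I\<close> exactly when its support
    is not contained in \<open>D\<close>. The colon ideal is then generated by the variables outside \<open>D\<close>, which
    makes it prime. On the chessboard, \<open>A\<close> is the beginning of the diagonal and \<open>D\<close> the whole
    diagonal.

  \<^item> Lower bound (\<open>le_v_number\<close>): let \<open>(I : f)\<close> be prime and choose a monomial of \<open>f\<close> that is not in
    \<open>I\<close>. Its support is a face \<open>A\<close> with at most \<open>deg f\<close> elements. If \<open>A\<close> could be extended by \<open>x\<close> and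
    also by \<open>y\<close> with \<open>{x, y}\<close> not a face, then \<open>x y \<in> I \<subseteq> (I : f)\<close> would force \<open>x f \<in> I\<close> or \<open>y f \<in> I\<close>,
    which the chosen monomial excludes. On the chessboard, fewer than \<open>min m (n - 1)\<close> rooks leave
    a free row and two free columns, and the two squares where they meet serve as \<open>x\<close> and \<open>y\<close>.
\<close>

section \<open>Monomials\<close>

lemma keys_add_exponents:
  fixes s t :: "'v \<Rightarrow>\<^sub>0 nat"
  shows "Poly_Mapping.keys (s + t) = Poly_Mapping.keys s \<union> Poly_Mapping.keys t"
  by (auto simp: in_keys_iff lookup_add)

lemma card_keys_le_mon_deg: "card (Poly_Mapping.keys t) \<le> mon_deg t"
proof -
  have "(\<Sum>v\<in>Poly_Mapping.keys t. 1) \<le> (\<Sum>v\<in>Poly_Mapping.keys t. Poly_Mapping.lookup t v)"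
    by (rule sum_mono) (auto simp: in_keys_iff Suc_le_eq)
  then show ?thesis
    by (simp add: mon_deg_def)
qed

definition sqfree_exponent :: "'v set \<Rightarrow> 'v \<Rightarrow>\<^sub>0 nat" where
  "sqfree_exponent A = (\<Sum>v\<in>A. Poly_Mapping.single v 1)"

lemma lookup_sqfree_exponent:
  "finite A \<Longrightarrow> Poly_Mapping.lookup (sqfree_exponent A) v = (if v \<in> A then 1 else 0)"
  by (simp add: sqfree_exponent_def lookup_sum lookup_single when_def)

lemma keys_sqfree_exponent: "finite A \<Longrightarrow> Poly_Mapping.keys (sqfree_exponent A) = A"
  by (auto simp: in_keys_iff lookup_sqfree_exponent split: if_splits)

lemma mon_deg_sqfree_exponent: "finite A \<Longrightarrow> mon_deg (sqfree_exponent A) = card A"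
  by (simp add: mon_deg_def keys_sqfree_exponent lookup_sqfree_exponent)

lemma prod_var_eq_single:
  "finite A \<Longrightarrow>
    (\<Prod>v\<in>A. var v :: ('v, 'k::field) mpoly) = Poly_Mapping.single (sqfree_exponent A) 1"
  by (induction A rule: finite_induct) (auto simp: sqfree_exponent_def var_def mult_single)

text \<open>
  Multiplication by a monomial shifts exponents injectively, so no terms can cancel. This gives
  the exact set of monomials of the product, where \<open>keys_mult\<close> has only an inclusion.
\<close>

lemma lookup_mult_single_shift:
  fixes f :: "('v, 'k::field) mpoly"
  shows "Poly_Mapping.lookup (f * Poly_Mapping.single s 1) (t + s) = Poly_Mapping.lookup f t"
proof -
  have "(\<Sum>q. Poly_Mapping.lookup (Poly_Mapping.single s (1::'k)) q when t + s = l + q) =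
    (1 when l = t)" for l
  proof -
    have "(\<lambda>q. Poly_Mapping.lookup (Poly_Mapping.single s (1::'k)) q when t + s = l + q) =
      (\<lambda>q. (1 when l = t) when q = s)"
      by (auto simp: fun_eq_iff lookup_single when_def)
    then show ?thesis
      by (simp only: Sum_any_when_equal)
  qed
  then show ?thesis
    by (simp add: lookup_mult mult_when)
qed

lemma keys_mult_single:
  fixes f :: "('v, 'k::field) mpoly"
  shows "Poly_Mapping.keys (f * Poly_Mapping.single s 1) = (\<lambda>t. t + s) ` Poly_Mapping.keys f"
proof
  show "Poly_Mapping.keys (f * Poly_Mapping.single s 1) \<subseteq> (\<lambda>t. t + s) ` Poly_Mapping.keys f"
    using keys_mult[of f "Poly_Mapping.single s (1::'k)"] by auto
  show "(\<lambda>t. t + s) ` Poly_Mapping.keys f \<subseteq> Poly_Mapping.keys (f * Poly_Mapping.single s 1)"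
    by (auto simp: in_keys_iff lookup_mult_single_shift)
qed

lemma sum_terms_eq:
  fixes f :: "('v, 'k::field) mpoly"
  shows "(\<Sum>t\<in>Poly_Mapping.keys f. Poly_Mapping.single t (Poly_Mapping.lookup f t)) = f"
  by (rule poly_mapping_eqI) (auto simp: lookup_sum lookup_single when_def in_keys_iff)

lemma poly_ring_simps:
  "mult (poly_ring V) = (*)" "one (poly_ring V) = 1"
  "zero (poly_ring V) = 0" "add (poly_ring V) = (+)"
  by (simp_all add: poly_ring_def)

lemma mem_carrier_poly_ring:
  "f \<in> carrier (poly_ring V) \<longleftrightarrow> (\<forall>t\<in>Poly_Mapping.keys f. Poly_Mapping.keys t \<subseteq> V)"
  by (simp add: poly_ring_def)

section \<open>Stanley-Reisner ideals\<close>

text \<open>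
  For a simplicial complex this is the Stanley-Reisner ideal, described by a basis instead of by
  generators; for the full simplex \<open>Pow D\<close> it is the ideal generated by the variables outside \<open>D\<close>.
\<close>

definition nonface_span :: "'v set \<Rightarrow> 'v set set \<Rightarrow> ('v, 'k::field) mpoly set" where
  "nonface_span V \<Delta> =
    {f \<in> carrier (poly_ring V). \<forall>t\<in>Poly_Mapping.keys f. Poly_Mapping.keys t \<notin> \<Delta>}"

definition down_closed :: "'v set set \<Rightarrow> bool" where
  "down_closed \<Delta> \<longleftrightarrow> (\<forall>F\<in>\<Delta>. \<forall>G. G \<subseteq> F \<longrightarrow> G \<in> \<Delta>)"

text \<open>
  Multiplication by a monomial enlarges the support, and a superset of a nonface is a nonface.
\<close>

lemma ideal_nonface_span:
  assumes "down_closed \<Delta>"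
  shows "ideal (nonface_span V \<Delta> :: ('v, 'k::field) mpoly set) (poly_ring V)"
proof -
  let ?R = "poly_ring V :: ('v, 'k) mpoly ring"
  interpret R: cring ?R by (rule cring_poly_ring)
  let ?J = "nonface_span V \<Delta> :: ('v, 'k) mpoly set"
  have absorb: "g * f \<in> ?J" if "f \<in> ?J" "g \<in> carrier ?R" for f g
  proof -
    have "f \<in> carrier ?R"
      using that by (simp add: nonface_span_def)
    then have "g * f \<in> carrier ?R"
      using R.m_closed[OF that(2)] by (simp add: poly_ring_simps)
    moreover have "Poly_Mapping.keys t \<notin> \<Delta>" if t: "t \<in> Poly_Mapping.keys (g * f)" for t
    proof -
      obtain a b where "t = a + b" "b \<in> Poly_Mapping.keys f"
        using t keys_mult[of g f] by auto
      then have "Poly_Mapping.keys b \<notin> \<Delta>" "Poly_Mapping.keys b \<subseteq> Poly_Mapping.keys t"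
        using \<open>f \<in> ?J\<close> by (auto simp: nonface_span_def keys_add_exponents)
      then show ?thesis
        using assms unfolding down_closed_def by blast
    qed
    ultimately show ?thesis
      by (simp add: nonface_span_def)
  qed
  show ?thesis
  proof (rule idealI[OF R.ring_axioms])
    show "subgroup ?J (add_monoid ?R)"
    proof (rule R.add.subgroupI)
      show "?J \<subseteq> carrier ?R"
        by (auto simp: nonface_span_def)
      have "0 \<in> ?J"
        by (simp add: nonface_span_def mem_carrier_poly_ring)
      then show "?J \<noteq> {}"
        by blast
    next
      fix f assume f: "f \<in> ?J"
      have "- 1 \<in> carrier ?R"
        by (auto simp: mem_carrier_poly_ring in_keys_iff lookup_one when_def split: if_splits)
      from absorb[OF f this] have "- f \<in> ?J"
        by simp
      moreover have "\<ominus>\<^bsub>?R\<^esub> f = - f"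
        using f \<open>- f \<in> ?J\<close>
        by (intro R.minus_equality) (auto simp: nonface_span_def poly_ring_simps)
      ultimately show "\<ominus>\<^bsub>?R\<^esub> f \<in> ?J"
        by simp
    next
      fix f g assume "f \<in> ?J" "g \<in> ?J"
      moreover have "t \<in> Poly_Mapping.keys f \<or> t \<in> Poly_Mapping.keys g"
        if "t \<in> Poly_Mapping.keys (f + g)" for t
        using that keys_add[of f g] by blast
      ultimately show "f \<oplus>\<^bsub>?R\<^esub> g \<in> ?J"
        by (simp add: nonface_span_def mem_carrier_poly_ring poly_ring_simps) blast
    qed
  qed (use absorb in \<open>simp_all add: poly_ring_simps mult.commute\<close>)
qed

text \<open>
  A monomial whose support \<open>A\<close> is a nonface is a multiple of the generator \<open>\<Prod>v\<in>A. var v\<close>; conversely,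
  the generators lie in the span, which is an ideal.
\<close>

lemma stanley_reisner_ideal_eq_nonface_span:
  assumes "finite V" and "down_closed \<Delta>"
  shows "stanley_reisner_ideal V \<Delta> = (nonface_span V \<Delta> :: ('v, 'k::field) mpoly set)"
proof
  let ?R = "poly_ring V :: ('v, 'k) mpoly ring"
  interpret R: cring ?R by (rule cring_poly_ring)
  let ?J = "nonface_span V \<Delta> :: ('v, 'k) mpoly set"
  let ?I = "stanley_reisner_ideal V \<Delta> :: ('v, 'k) mpoly set"
  let ?G = "{\<Prod>v\<in>F. var v | F. F \<subseteq> V \<and> F \<notin> \<Delta>} :: ('v, 'k) mpoly set"
  have fin: "finite F" if "F \<subseteq> V" for F
    using that assms(1) finite_subset by blast
  have GJ: "?G \<subseteq> ?J"
    by (auto simp: prod_var_eq_single fin nonface_span_def mem_carrier_poly_ring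
        keys_sqfree_exponent)
  then show "?I \<subseteq> ?J"
    unfolding stanley_reisner_ideal_def
    by (rule R.genideal_minimal[OF ideal_nonface_span[OF assms(2)]])
  have "?G \<subseteq> carrier ?R"
    using GJ by (auto simp: nonface_span_def)
  then interpret I: ideal ?I ?R
    unfolding stanley_reisner_ideal_def by (rule R.genideal_ideal)
  have G_sub: "?G \<subseteq> ?I"
    unfolding stanley_reisner_ideal_def using \<open>?G \<subseteq> carrier ?R\<close> by (rule R.genideal_self)
  have term_mem: "Poly_Mapping.single t c \<in> ?I"
    if "Poly_Mapping.keys t \<subseteq> V" "Poly_Mapping.keys t \<notin> \<Delta>" for t c
  proof -
    let ?A = "Poly_Mapping.keys t"
    let ?s = "sqfree_exponent ?A"
    have split: "(t - ?s) + ?s = t"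
      by (rule poly_mapping_eqI)
        (auto simp: lookup_add lookup_minus lookup_sqfree_exponent in_keys_iff)
    have "Poly_Mapping.keys (t - ?s) \<subseteq> ?A"
      by (auto simp: in_keys_iff lookup_minus)
    then have "Poly_Mapping.single (t - ?s) c \<in> carrier ?R"
      using that by (auto simp: mem_carrier_poly_ring)
    moreover have "(\<Prod>v\<in>?A. var v) \<in> ?I"
      using G_sub that by blast
    then have "Poly_Mapping.single ?s 1 \<in> ?I"
      by (simp add: prod_var_eq_single)
    ultimately have "Poly_Mapping.single (t - ?s) c * Poly_Mapping.single ?s 1 \<in> ?I"
      using I.I_l_closed by (fastforce simp: poly_ring_simps)
    then show ?thesis
      by (simp add: mult_single split)
  qed
  have sum_mem: "sum h T \<in> ?I" if "finite T" "\<And>t. t \<in> T \<Longrightarrow> h t \<in> ?I"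
    for h :: "('v \<Rightarrow>\<^sub>0 nat) \<Rightarrow> ('v, 'k) mpoly" and T
    using that
  proof (induction T rule: finite_induct)
    case empty
    show ?case
      using I.zero_closed by (simp add: poly_ring_simps)
  next
    case (insert t T)
    then show ?case
      using I.a_closed[of "h t" "sum h T"] by (simp add: poly_ring_simps)
  qed
  show "?J \<subseteq> ?I"
  proof
    fix f assume f: "f \<in> ?J"
    have "(\<Sum>t\<in>Poly_Mapping.keys f. Poly_Mapping.single t (Poly_Mapping.lookup f t)) \<in> ?I"
      by (rule sum_mem[OF finite_keys term_mem])
        (use f in \<open>auto simp: nonface_span_def mem_carrier_poly_ring\<close>)
    then show "f \<in> ?I"
      by (simp add: sum_terms_eq)
  qed
qed

lemma nonface_span_diff:
  assumes "f \<in> nonface_span V \<Delta>" and "g \<in> nonface_span V \<Delta>"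
  shows "f - g \<in> nonface_span V \<Delta>"
proof -
  have "t \<in> Poly_Mapping.keys f \<or> t \<in> Poly_Mapping.keys g"
    if "t \<in> Poly_Mapping.keys (f - g)" for t
    using that keys_diff[of f g] by blast
  then show ?thesis
    using assms by (simp add: nonface_span_def mem_carrier_poly_ring) blast
qed

lemma down_closed_Pow: "down_closed (Pow D)"
  by (auto simp: down_closed_def)

text \<open>
  Setting the variables outside \<open>D\<close> to zero maps the polynomial ring to a polynomial ring in the
  variables of \<open>D\<close>, a domain, and the ideal is the kernel. A linear order on the variables
  gives a monomial order, for which leading monomials multiply; this is why there are no zero
  divisors.
\<close>

lemma primeideal_nonface_span_simplex:
  fixes V D :: "'v::linorder set"
  shows "primeideal (nonface_span V (Pow D) :: ('v, 'k::field) mpoly set) (poly_ring V)"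
proof (rule primeidealI)
  let ?R = "poly_ring V :: ('v, 'k) mpoly ring"
  let ?P = "nonface_span V (Pow D) :: ('v, 'k) mpoly set"
  show idealP: "ideal ?P ?R"
    by (rule ideal_nonface_span[OF down_closed_Pow])
  interpret P: ideal ?P ?R by (rule idealP)
  show "cring ?R" by (rule cring_poly_ring)
  have "1 \<in> carrier ?R" "1 \<notin> ?P"
    by (auto simp: mem_carrier_poly_ring nonface_span_def)
  then show "carrier ?R \<noteq> ?P"
    by blast
  fix f g assume fg: "f \<in> carrier ?R" "g \<in> carrier ?R" "f \<otimes>\<^bsub>?R\<^esub> g \<in> ?P"
  \<comment> \<open>\<open>\<rho>\<close> sets the variables outside \<open>D\<close> to zero by discarding the terms that involve them.\<close>
  define \<rho> :: "('v, 'k) mpoly \<Rightarrow> ('v, 'k) mpoly"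
    where "\<rho> h = Poly_Mapping.mapp (\<lambda>t c. c when Poly_Mapping.keys t \<subseteq> D) h" for h
  have lookup_\<rho>:
    "Poly_Mapping.lookup (\<rho> h) t = (Poly_Mapping.lookup h t when Poly_Mapping.keys t \<subseteq> D)" for h t
    by (auto simp: \<rho>_def lookup_mapp when_def in_keys_iff)
  have \<rho>_carrier: "\<rho> h \<in> carrier ?R" if "h \<in> carrier ?R" for h
    using that by (auto simp: mem_carrier_poly_ring in_keys_iff lookup_\<rho>)
  have \<rho>_diff: "h - \<rho> h \<in> ?P" if "h \<in> carrier ?R" for h
    using that
    by (auto simp: nonface_span_def mem_carrier_poly_ring in_keys_iff lookup_\<rho> lookup_minus when_def
        split: if_splits)
  have \<rho>_zero: "h \<in> ?P" if "h \<in> carrier ?R" "\<rho> h = 0" for h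
    using \<rho>_diff[OF that(1)] that(2) by simp
  \<comment> \<open>Modulo the ideal, \<open>f\<close> and \<open>g\<close> may be replaced by \<open>\<rho> f\<close> and \<open>\<rho> g\<close>, so \<open>\<rho> f * \<rho> g\<close> is in the ideal.
    As it involves only variables of \<open>D\<close>, it has no terms at all.\<close>
  have "(f - \<rho> f) * g \<in> ?P" "\<rho> f * (g - \<rho> g) \<in> ?P"
    using P.I_r_closed[OF \<rho>_diff[OF fg(1)] fg(2)]
      P.I_l_closed[OF \<rho>_diff[OF fg(2)] \<rho>_carrier[OF fg(1)]]
    by (simp_all add: poly_ring_simps)
  then have "(f - \<rho> f) * g + \<rho> f * (g - \<rho> g) \<in> ?P" (is "?e \<in> _")
    using additive_subgroup.a_closed[OF P.additive_subgroup_axioms] by (metis poly_ring_simps(4))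
  moreover have "\<rho> f * \<rho> g = f * g - ?e"
    by (simp add: algebra_simps)
  moreover have "f * g \<in> ?P"
    using fg(3) by (simp add: poly_ring_simps)
  ultimately have "\<rho> f * \<rho> g \<in> ?P"
    using nonface_span_diff by metis
  moreover have "Poly_Mapping.keys t \<in> Pow D" if t: "t \<in> Poly_Mapping.keys (\<rho> f * \<rho> g)" for t
  proof -
    obtain a b where "t = a + b" "a \<in> Poly_Mapping.keys (\<rho> f)" "b \<in> Poly_Mapping.keys (\<rho> g)"
      using t keys_mult[of "\<rho> f" "\<rho> g"] by auto
    then show ?thesis
      by (simp add: keys_add_exponents in_keys_iff[of _ "\<rho> _"] lookup_\<rho>)
  qed
  ultimately have "Poly_Mapping.keys (\<rho> f * \<rho> g) = {}"
    unfolding nonface_span_def by blast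
  then have "\<rho> f * \<rho> g = 0"
    by simp
  then have "\<rho> f = 0 \<or> \<rho> g = 0"
    by simp
  then show "f \<in> ?P \<or> g \<in> ?P"
    using \<rho>_zero fg by blast
qed

section \<open>Bounds on the v-number of a Stanley-Reisner ideal\<close>

text \<open>
  The colon ideal \<open>(I : f)\<close> is the annihilator of the coset of \<open>f\<close> in the quotient by \<open>I\<close>.
\<close>

lemma colon_mem_Ass:
  assumes "ideal I R" and "cring R" and "f \<in> carrier R" and "primeideal (colon R I f) R"
  shows "colon R I f \<in> Ass R I"
proof -
  interpret I: ideal I R by fact
  interpret R: cring R by fact
  have eq: "(I +>\<^bsub>R\<^esub> r) \<otimes>\<^bsub>R Quot I\<^esub> (I +>\<^bsub>R\<^esub> f) = \<zero>\<^bsub>R Quot I\<^esub> \<longleftrightarrow> r \<otimes>\<^bsub>R\<^esub> f \<in> I"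
    if r: "r \<in> carrier R" for r
  proof -
    have "(I +>\<^bsub>R\<^esub> r) \<otimes>\<^bsub>R Quot I\<^esub> (I +>\<^bsub>R\<^esub> f) = I +>\<^bsub>R\<^esub> (r \<otimes>\<^bsub>R\<^esub> f)"
      using r assms(3) by (simp add: FactRing_def I.rcoset_mult_add)
    moreover have "\<zero>\<^bsub>R Quot I\<^esub> = I"
      by (simp add: FactRing_def)
    moreover have "I +>\<^bsub>R\<^esub> (r \<otimes>\<^bsub>R\<^esub> f) = I \<longleftrightarrow> r \<otimes>\<^bsub>R\<^esub> f \<in> I"
      using I.rcos_const_imp_mem[of "r \<otimes>\<^bsub>R\<^esub> f"] I.a_rcos_const[of "r \<otimes>\<^bsub>R\<^esub> f"] r assms(3)
      by auto
    ultimately show ?thesis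
      by simp
  qed
  have "I +>\<^bsub>R\<^esub> f \<in> carrier (R Quot I)"
    using assms(3) by (auto simp: FactRing_def A_RCOSETS_def')
  moreover have "colon R I f =
    {r \<in> carrier R. (I +>\<^bsub>R\<^esub> r) \<otimes>\<^bsub>R Quot I\<^esub> (I +>\<^bsub>R\<^esub> f) = \<zero>\<^bsub>R Quot I\<^esub>}"
    using eq by (auto simp: colon_def)
  ultimately show ?thesis
    using assms(4) unfolding Ass_def by blast
qed

text \<open>
  The hypothesis on \<open>A\<close> says that the star of \<open>A\<close> in \<open>\<Delta>\<close> is the simplex on \<open>D \<inter> V\<close>. Since
  \<open>(I : \<Prod>v\<in>A. var v)\<close> is the Stanley-Reisner ideal of the star, it is prime, and the product
  has degree \<open>card A\<close>.
\<close>

lemma v_number_le: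
  fixes V A D :: "'v::linorder set"
  assumes "finite V" and "down_closed \<Delta>" and "A \<subseteq> V"
    and star: "\<And>F. F \<subseteq> V \<Longrightarrow> F \<union> A \<in> \<Delta> \<longleftrightarrow> F \<subseteq> D"
  shows "v_number V (stanley_reisner_ideal V \<Delta> :: ('v, 'k::field) mpoly set) \<le> enat (card A)"
proof -
  let ?R = "poly_ring V :: ('v, 'k) mpoly ring"
  let ?I = "stanley_reisner_ideal V \<Delta> :: ('v, 'k) mpoly set"
  let ?P = "nonface_span V (Pow D) :: ('v, 'k) mpoly set"
  let ?f = "Poly_Mapping.single (sqfree_exponent A) 1 :: ('v, 'k) mpoly"
  interpret R: cring ?R by (rule cring_poly_ring)
  have "finite A"
    using assms(1,3) finite_subset by blast
  have I_eq: "?I = nonface_span V \<Delta>"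
    by (rule stanley_reisner_ideal_eq_nonface_span[OF assms(1,2)])
  have f: "?f \<in> homogeneous_part V (card A)"
    using \<open>finite A\<close> assms(3)
    by (simp add: homogeneous_part_def mem_carrier_poly_ring keys_sqfree_exponent
        mon_deg_sqfree_exponent)
  then have f_carrier: "?f \<in> carrier ?R"
    by (simp add: homogeneous_part_def)
  have colon_eq: "colon ?R ?I ?f = ?P"
  proof -
    have "g * ?f \<in> ?I \<longleftrightarrow> g \<in> ?P" if g: "g \<in> carrier ?R" for g
    proof -
      have "g * ?f \<in> carrier ?R"
        using R.m_closed[OF g f_carrier] by (simp add: poly_ring_simps)
      then have "g * ?f \<in> ?I \<longleftrightarrow> (\<forall>t\<in>Poly_Mapping.keys g. Poly_Mapping.keys t \<union> A \<notin> \<Delta>)"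
        using \<open>finite A\<close>
        by (simp add: I_eq nonface_span_def keys_mult_single keys_add_exponents
            keys_sqfree_exponent)
      also have "\<dots> \<longleftrightarrow> g \<in> ?P"
        using g star by (auto simp: nonface_span_def mem_carrier_poly_ring)
      finally show ?thesis .
    qed
    then show ?thesis
      by (auto simp: colon_def poly_ring_simps nonface_span_def)
  qed
  have "ideal ?I ?R"
    unfolding I_eq by (rule ideal_nonface_span[OF assms(2)])
  then have "colon ?R ?I ?f \<in> Ass ?R ?I"
    using R.is_cring f_carrier
    by (rule colon_mem_Ass) (simp only: colon_eq primeideal_nonface_span_simplex)
  then have "?P \<in> Ass ?R ?I"
    by (simp only: colon_eq)
  then have "v_number V ?I \<le> v_number_at V ?I ?P"
    unfolding v_number_def by (intro Inf_lower) auto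
  also have "\<dots> \<le> enat (card A)"
    unfolding v_number_at_def using f colon_eq by (intro Inf_lower) auto
  finally show ?thesis .
qed

text \<open>
  The hypothesis keeps the star of a face with fewer than \<open>d\<close> vertices from being a simplex, in
  the strong form that two vertices of the star are not joined by an edge of \<open>\<Delta>\<close>. The proof
  needs only one monomial of \<open>f\<close>: the conflicting vertices \<open>x\<close> and \<open>y\<close> for its support contradict
  primeness because \<open>var x * var y\<close> lies in the ideal, while neither \<open>var x * f\<close> nor \<open>var y * f\<close>
  does.
\<close>

lemma le_v_number:
  fixes V :: "'v set"
  assumes "finite V" and "down_closed \<Delta>"
    and extend: "\<And>A. A \<subseteq> V \<Longrightarrow> A \<in> \<Delta> \<Longrightarrow> card A < d \<Longrightarrow>
      \<exists>x\<in>V. \<exists>y\<in>V. insert x A \<in> \<Delta> \<and> insert y A \<in> \<Delta> \<and> {x, y} \<notin> \<Delta>"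
  shows "enat d \<le> v_number V (stanley_reisner_ideal V \<Delta> :: ('v, 'k::field) mpoly set)"
proof -
  let ?R = "poly_ring V :: ('v, 'k) mpoly ring"
  let ?I = "stanley_reisner_ideal V \<Delta> :: ('v, 'k) mpoly set"
  interpret R: cring ?R by (rule cring_poly_ring)
  have I_eq: "?I = nonface_span V \<Delta>"
    by (rule stanley_reisner_ideal_eq_nonface_span[OF assms(1,2)])
  have mem_I: "h \<in> ?I \<longleftrightarrow>
      h \<in> carrier ?R \<and> (\<forall>t\<in>Poly_Mapping.keys h. Poly_Mapping.keys t \<notin> \<Delta>)" for h
    by (simp add: I_eq nonface_span_def)
  interpret I: ideal ?I ?R
    unfolding I_eq by (rule ideal_nonface_span[OF assms(2)])
  have "d \<le> e" if P: "primeideal P ?R" and f: "f \<in> homogeneous_part V e" and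
    colon: "colon ?R ?I f = P" for P e f
  proof (rule ccontr)
    assume "\<not> d \<le> e"
    have f_carrier: "f \<in> carrier ?R"
      using f by (simp add: homogeneous_part_def)
    have "f \<notin> ?I"
    proof
      assume "f \<in> ?I"
      then have "colon ?R ?I f = carrier ?R"
        using I.I_l_closed by (auto simp: colon_def)
      then show False
        using colon primeideal.I_notcarr[OF P] by blast
    qed
    then obtain t where t: "t \<in> Poly_Mapping.keys f" "Poly_Mapping.keys t \<in> \<Delta>"
      using f_carrier mem_I by blast
    let ?A = "Poly_Mapping.keys t"
    have "?A \<subseteq> V"
      using f_carrier t by (auto simp: mem_carrier_poly_ring)
    moreover have "card ?A < d"
      using card_keys_le_mon_deg[of t] f t(1) \<open>\<not> d \<le> e\<close> by (auto simp: homogeneous_part_def)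
    ultimately obtain x y where xy: "x \<in> V" "y \<in> V"
      "insert x ?A \<in> \<Delta>" "insert y ?A \<in> \<Delta>" "{x, y} \<notin> \<Delta>"
      using extend t(2) by blast
    have var_notin: "var z \<notin> P" if "insert z ?A \<in> \<Delta>" for z
    proof
      assume "var z \<in> P"
      then have "var z * f \<in> ?I"
        using colon by (auto simp: colon_def poly_ring_simps)
      moreover have "t + Poly_Mapping.single z 1 \<in> Poly_Mapping.keys (var z * f)"
        using t(1) by (simp add: var_def mult.commute[of _ f] keys_mult_single)
      ultimately show False
        using that unfolding mem_I by (force simp: keys_add_exponents)
    qed
    have var_carrier: "var x \<in> carrier ?R" "var y \<in> carrier ?R"
      using xy by (simp_all add: var_def mem_carrier_poly_ring)
    have "var x * var y \<in> ?I"
      using xy by (simp add: mem_I var_def mult_single mem_carrier_poly_ring keys_add_exponents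
          insert_commute)
    then have "var x * var y * f \<in> ?I"
      using I.I_r_closed[of "var x * var y" f] f_carrier by (simp add: poly_ring_simps)
    then have "var x \<otimes>\<^bsub>?R\<^esub> var y \<in> P"
      using colon R.m_closed[OF var_carrier] by (auto simp: colon_def poly_ring_simps)
    then show False
      using primeideal.I_prime[OF P var_carrier] var_notin xy(3,4) by blast
  qed
  then have "enat d \<le> v_number_at V ?I P" if "P \<in> Ass ?R ?I" for P
    using that unfolding v_number_at_def Ass_def by (intro Inf_greatest) auto
  then show ?thesis
    unfolding v_number_def by (intro Inf_greatest) auto
qed

section \<open>The chessboard complex\<close>

lemma down_closed_chessboard_complex: "down_closed (chessboard_complex m n)"
  unfolding down_closed_def chessboard_complex_def by blast

lemma finite_board: "finite (board m n)"
  by (simp add: board_def)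

text \<open>
  Fewer than \<open>m\<close> rooks leave a row free, and fewer than \<open>n - 1\<close> leave two columns free. The two
  squares of that row in these columns attack each other, but no rook of \<open>A\<close>.
\<close>

lemma chessboard_two_extensions:
  assumes A: "A \<in> chessboard_complex m n" and small: "card A < min m (n - 1)"
  shows "\<exists>x\<in>board m n. \<exists>y\<in>board m n.
    insert x A \<in> chessboard_complex m n \<and> insert y A \<in> chessboard_complex m n \<and>
    {x, y} \<notin> chessboard_complex m n"
proof -
  have "A \<subseteq> board m n"
    using A by (simp add: chessboard_complex_def)
  then have "finite A"
    using finite_board finite_subset by blast
  let ?rows = "{1..m} - fst ` A" and ?cols = "{1..n} - snd ` A"
  have "card (fst ` A) \<le> card A" "card (snd ` A) \<le> card A"
    using \<open>finite A\<close> card_image_le by blast+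
  moreover have "card {1..m} - card (fst ` A) \<le> card ?rows"
    "card {1..n} - card (snd ` A) \<le> card ?cols"
    using \<open>finite A\<close> by (intro diff_card_le_card_Diff; simp)+
  ultimately have "0 < card ?rows" "1 < card ?cols"
    using small by auto
  then have "?rows \<noteq> {}" "\<not> (\<forall>j\<in>?cols. \<forall>j'\<in>?cols. j = j')"
    using card_le_Suc0_iff_eq[of ?cols] by (auto simp: card_gt_0_iff)
  then obtain i j j' where ij: "i \<in> ?rows" "j \<in> ?cols" "j' \<in> ?cols" "j \<noteq> j'"
    by blast
  have "insert (i, k) A \<in> chessboard_complex m n" if "k \<in> ?cols" for k
  proof -
    have "fst a \<noteq> i" "snd a \<noteq> k" if "a \<in> A" for a
      using ij(1) \<open>k \<in> ?cols\<close> that by auto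
    moreover have "(i, k) \<in> board m n"
      using ij(1) that by (simp add: board_def)
    ultimately show ?thesis
      using A by (simp add: chessboard_complex_def) metis
  qed
  moreover have "{(i, j), (i, j')} \<notin> chessboard_complex m n"
    using ij(4) by (auto simp: chessboard_complex_def)
  moreover have "(i, j) \<in> board m n" "(i, j') \<in> board m n"
    using ij by (auto simp: board_def)
  ultimately show ?thesis
    using ij(2,3) by blast
qed

text \<open>
  Every square \<open>(i, j)\<close> off the diagonal is attacked by one of the rooks \<open>(k, k)\<close> with
  \<open>k \<le> min m (n - 1)\<close>: either \<open>k = i\<close> works, or \<open>i = m = n\<close>, and then \<open>j \<noteq> i\<close> gives \<open>j \<le> n - 1\<close>, so
  \<open>k = j\<close> works. So only diagonal squares can be added.
\<close>

lemma chessboard_star_of_diagonal: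
  assumes "m \<le> n" and F: "F \<subseteq> board m n"
  shows "F \<union> (\<lambda>i. (i, i)) ` {1..min m (n - 1)} \<in> chessboard_complex m n \<longleftrightarrow>
    F \<subseteq> (\<lambda>i. (i, i)) ` {1..m}"
    (is "F \<union> ?A \<in> _ \<longleftrightarrow> F \<subseteq> ?D")
proof
  assume face: "F \<union> ?A \<in> chessboard_complex m n"
  show "F \<subseteq> ?D"
  proof
    fix v assume "v \<in> F"
    obtain i j where v: "v = (i, j)"
      by fastforce
    have ij: "i \<in> {1..m}" "j \<in> {1..n}"
      using \<open>v \<in> F\<close> F v by (auto simp: board_def)
    have diag: "i = j" if "k \<in> {1..min m (n - 1)}" "k = i \<or> k = j" for k
    proof -
      have mem: "(k, k) \<in> F \<union> ?A" "(i, j) \<in> F \<union> ?A"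
        using that \<open>v \<in> F\<close> v by auto
      have "\<forall>a\<in>F \<union> ?A. \<forall>b\<in>F \<union> ?A. a \<noteq> b \<longrightarrow> fst a \<noteq> fst b \<and> snd a \<noteq> snd b"
        using face by (simp add: chessboard_complex_def)
      from bspec[OF bspec[OF this mem(1)] mem(2)] show ?thesis
        using that(2) by auto
    qed
    have "i = j"
    proof (rule ccontr)
      assume "i \<noteq> j"
      then have "i \<in> {1..min m (n - 1)} \<or> j \<in> {1..min m (n - 1)}"
        using ij \<open>m \<le> n\<close> by auto
      then show False
        using diag \<open>i \<noteq> j\<close> by blast
    qed
    then show "v \<in> ?D"
      using v ij by blast
  qed
next
  assume "F \<subseteq> ?D"
  then have "F \<union> ?A \<subseteq> ?D"
    by auto
  moreover have "?D \<in> chessboard_complex m n"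
    using \<open>m \<le> n\<close> by (auto simp: chessboard_complex_def board_def)
  ultimately show "F \<union> ?A \<in> chessboard_complex m n"
    using down_closed_chessboard_complex unfolding down_closed_def by blast
qed

theorem theorem1p1:
  fixes m n :: nat
  assumes "1 \<le> m" and "m \<le> n"
  shows "v_number (board m n)
           (stanley_reisner_ideal (board m n) (chessboard_complex m n)
              :: (nat \<times> nat, 'k::field) mpoly set)
         = enat (if m = n then m - 1 else m)"
proof -
  let ?I = "stanley_reisner_ideal (board m n) (chessboard_complex m n)
    :: (nat \<times> nat, 'k) mpoly set"
  let ?A = "(\<lambda>i. (i, i)) ` {1..min m (n - 1)}"
  have "?A \<subseteq> board m n"
    using assms(2) by (auto simp: board_def)
  then have "v_number (board m n) ?I \<le> enat (card ?A)"
    by (rule v_number_le[OF finite_board down_closed_chessboard_complex _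
          chessboard_star_of_diagonal[OF assms(2)]])
  also have "card ?A = min m (n - 1)"
    by (simp add: card_image inj_on_def)
  finally have "v_number (board m n) ?I \<le> enat (min m (n - 1))" .
  moreover have "enat (min m (n - 1)) \<le> v_number (board m n) ?I"
    by (rule le_v_number[OF finite_board down_closed_chessboard_complex
          chessboard_two_extensions])
  ultimately have "v_number (board m n) ?I = enat (min m (n - 1))"
    by (rule antisym)
  moreover have "min m (n - 1) = (if m = n then m - 1 else m)"
    using assms by auto
  ultimately show ?thesis
    by simp
qed

end
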